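(* For every $n\ge 1$, the complete graph $K_n$ has an ESD labeling with label set $\{1,\dots,F_{n+1}\}$.
   Context: The Fibonacci sequence is $F_0=0$, $F_1=1$, $F_m=F_{m-1}+F_{m-2}$ for $m>1$. For a graph $G=(V,E)$ and $l\in\mathbb N$, a vertex labeling $\phi:V\to\{1,\dots,l\}$ is an edge-sum distinguishing (ESD) labeling if $\phi$ is injective and the edge-weights $w_\phi(uv)=\phi(u)+\phi(v)$ are pairwise distinct over all edges $uv\in E$. *)

theory Defs
  imports "HOL-Library.FuncSet" "HOL-Number_Theory.Fib"
begin

type_synonym 'a ugraph = "'a set \<times> 'a set set"

definition simple_graph :: "'a ugraph \<Rightarrow> bool" where
  "simple_graph G \<longleftrightarrow> finite (fst G) \<and> (\<forall>e \<in> snd G. e \<subseteq> fst G \<and> card e = 2)"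

definition complete_graph :: "'a set \<Rightarrow> 'a ugraph" where
  "complete_graph V = (V, {e. e \<subseteq> V \<and> card e = 2})"

(* Edges are two-element sets, so the weight of {u, v} is \<phi> u + \<phi> v; see edge_weight_doubleton. *)
definition edge_weight :: "('a \<Rightarrow> nat) \<Rightarrow> 'a set \<Rightarrow> nat" where
  "edge_weight \<phi> e = (\<Sum>v\<in>e. \<phi> v)"

(* The labeling is a total function on the type, of which only the values on the vertices matter;
   it need not be onto {1..l}. *)
definition esd_labeling :: "'a ugraph \<Rightarrow> nat \<Rightarrow> ('a \<Rightarrow> nat) \<Rightarrow> bool" where
  "esd_labeling G l \<phi> \<longleftrightarrow>
     simple_graph G \<and> \<phi> \<in> fst G \<rightarrow> {1..l} \<and>
     inj_on \<phi> (fst G) \<and> inj_on (edge_weight \<phi>) (snd G)"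

lemma edge_weight_doubleton: "u \<noteq> v \<Longrightarrow> edge_weight \<phi> {u, v} = \<phi> u + \<phi> v"
  by (simp add: edge_weight_def)

lemma simple_graph_complete_graph: "finite V \<Longrightarrow> simple_graph (complete_graph V)"
  by (simp add: simple_graph_def complete_graph_def)

end

theory Submission
  imports Defs
begin

text \<open>Label the vertices by $F_2, \dots, F_{n+1}$. For $i < j$ the sum $F_i + F_j$ lies in the interval
  $(F_j, F_{j+1}]$. These intervals are disjoint for distinct $j$, so the sum determines $j$ and
  hence $F_i$.\<close>

text \<open>The shift by 2 skips the repeated value \<open>fib 1 = fib 2\<close>; from there on each
  step adds a positive Fibonacci number.\<close>

lemma strict_mono_fib_add_2: "strict_mono (\<lambda>k. fib (k + 2))"
  by (simp add: strict_mono_Suc_iff fib_neq_0_nat)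

lemma fib_sum_less:
  assumes "i < j" "j < k"
  shows "fib (i + 2) + fib (j + 2) < fib (h + 2) + fib (k + 2)"
proof -
  have mono: "fib (a + 2) \<le> fib (b + 2)" if "a \<le> b" for a b
    using strict_mono_less_eq[OF strict_mono_fib_add_2] that by simp
  \<comment> \<open>Since i < j, the index j is positive and \<open>fib (j + 1)\<close> is the
    shifted value at \<open>j - 1\<close>. The recurrence then absorbs
    \<open>fib (j + 1) + fib (j + 2)\<close> into \<open>fib (Suc j + 2)\<close>.\<close>
  have "fib (i + 2) \<le> fib (j + 1)"
    using mono[of i "j - 1"] assms(1) by (cases j) auto
  then have "fib (i + 2) + fib (j + 2) \<le> fib (Suc j + 2)"
    by simp
  also have "\<dots> \<le> fib (k + 2)"
    using assms(2) by (intro mono) simp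
  also have "\<dots> < fib (h + 2) + fib (k + 2)"
    by (simp add: fib_neq_0_nat)
  finally show ?thesis .
qed

lemma fib_sum_inject:
  assumes "i < j" "h < k" "fib (i + 2) + fib (j + 2) = fib (h + 2) + fib (k + 2)"
  shows "i = h \<and> j = k"
proof -
  \<comment> \<open>If j < k or k < j, one of the two instances makes the equal sums differ
    strictly.\<close>
  have "j = k"
    using fib_sum_less[of i j k h] fib_sum_less[of h k j i] assms
    by (metis less_irrefl nat_neq_iff)
  moreover from this have "i = h"
    using strict_mono_eq[OF strict_mono_fib_add_2, of i h] assms(3) by simp
  ultimately show ?thesis by simp
qed

theorem theorem10:
  fixes n :: nat and V :: "'a set"
  assumes "n \<ge> 1" and "finite V" and "card V = n"
  shows "\<exists>\<phi>. esd_labeling (complete_graph V) (fib (n + 1)) \<phi>"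
proof -
  obtain f where f: "bij_betw f V {0..<n}"
    using ex_bij_betw_finite_nat assms(2,3) by blast
  then have inj: "inj_on f V" by (simp add: bij_betw_def)
  \<comment> \<open>As f numbers the vertices from 0, the labels run from \<open>fib 2\<close> to
    \<open>fib (n + 1)\<close>.\<close>
  define \<phi> where "\<phi> v = fib (f v + 2)" for v
  \<comment> \<open>Each edge is oriented by f, smaller end first, to match the form i < j of
    \<open>fib_sum_inject\<close>.\<close>
  have edge: "\<exists>u v. u \<in> V \<and> v \<in> V \<and> f u < f v \<and> e = {u, v} \<and>
      edge_weight \<phi> e = fib (f u + 2) + fib (f v + 2)"
    if "e \<subseteq> V" "card e = 2" for e
  proof -
    obtain u v where e: "e = {u, v}" "u \<noteq> v"
      using \<open>card e = 2\<close> by (auto simp: card_2_iff)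
    have ordered: "\<exists>u v. u \<in> V \<and> v \<in> V \<and> f u < f v \<and> e = {u, v} \<and>
        edge_weight \<phi> e = fib (f u + 2) + fib (f v + 2)"
      if "e = {x, y}" "x \<noteq> y" "f x < f y" for x y
      using that \<open>e \<subseteq> V\<close> edge_weight_doubleton[of x y \<phi>] unfolding \<phi>_def by blast
    have "f u \<noteq> f v"
      using inj e \<open>e \<subseteq> V\<close> by (auto dest: inj_onD)
    then show ?thesis
      using ordered[of u v] ordered[of v u] e by (metis insert_commute nat_neq_iff)
  qed
  have "inj_on (edge_weight \<phi>) {e. e \<subseteq> V \<and> card e = 2}"
  proof (rule inj_onI)
    fix d e
    assume "d \<in> {e. e \<subseteq> V \<and> card e = 2}" "e \<in> {e. e \<subseteq> V \<and> card e = 2}"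
      and eq: "edge_weight \<phi> d = edge_weight \<phi> e"
    then obtain a b u v where
      d: "a \<in> V" "b \<in> V" "f a < f b" "d = {a, b}"
        "edge_weight \<phi> d = fib (f a + 2) + fib (f b + 2)" and
      e: "u \<in> V" "v \<in> V" "f u < f v" "e = {u, v}"
        "edge_weight \<phi> e = fib (f u + 2) + fib (f v + 2)"
      using edge[of d] edge[of e] by blast
    have "f a = f u \<and> f b = f v"
      using d(3,5) e(3,5) eq by (intro fib_sum_inject) auto
    \<comment> \<open>Equal numbers under f mean equal endpoints, so the edges coincide as
      sets.\<close>
    then show "d = e"
      using inj d e by (auto dest: inj_onD)
  qed
  moreover have "inj_on \<phi> V"
    unfolding \<phi>_def using inj strict_mono_eq[OF strict_mono_fib_add_2]
    by (auto simp: inj_on_def)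
  moreover have "\<phi> \<in> V \<rightarrow> {1..fib (n + 1)}"
  proof
    fix v assume "v \<in> V"
    then have "f v \<le> n - 1"
      using bij_betwE[OF f] by fastforce
    then have "fib (f v + 2) \<le> fib (n - 1 + 2)"
      using strict_mono_less_eq[OF strict_mono_fib_add_2] by blast
    \<comment> \<open>Subtraction on naturals truncates at 0, so this equation rests on n \<ge>
      1.\<close>
    moreover have "n - 1 + 2 = n + 1"
      using assms(1) by simp
    moreover have "fib (f v + 2) \<ge> 1"
      using fib_neq_0_nat[of "f v + 2"] by linarith
    ultimately show "\<phi> v \<in> {1..fib (n + 1)}"
      unfolding \<phi>_def by (simp only: atLeastAtMost_iff)
  qed
  ultimately have "esd_labeling (complete_graph V) (fib (n + 1)) \<phi>"
    using simple_graph_complete_graph[OF assms(2)]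
    by (simp add: esd_labeling_def complete_graph_def)
  then show ?thesis by blast
qed

end
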